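(* Let $p$ be a prime, let $r \le s$ be positive integers, and let $n, m$ be positive integers. Then \[P_{\mathbb{Z}_{p^{r}} \times \mathbb{Z}_{p^{s}}} = \frac{(r+1)(s+1)(p-1)^2}{p^{r+1}[(s-r+1)(p-1)+2]- [(s+r+3)(p-1)+2]}.\] Moreover, let $p_1, \dots, p_k$ be the distinct primes dividing $mn$, and write $m = p_1^{r_1}\cdots p_k^{r_k}$ and $n = p_1^{s_1}\cdots p_k^{s_k}$ with non-negative integer exponents $r_i, s_i$. Then \[ P_{\mathbb{Z}_n \times \mathbb{Z}_m} = \prod_{i=1}^k \frac{(r_i+1)(s_i+1)(p_i-1)^2}{p_i^{\min(r_i,s_i)+1}[(|s_i-r_i|+1)(p_i-1)+2]- [(s_i+r_i+3)(p_i-1)+2]}.\]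
   Context: $\mathbb{Z}_N$ denotes the ring of integers modulo $N$; products of rings carry componentwise operations. For a finite commutative ring $R$, $P_R$ denotes the probability that a randomly chosen subgroup of $(R,+)$ is an ideal of $R$, i.e. $P_R$ is the total number of ideals of $R$ divided by the total number of subgroups of $(R,+)$. *)

theory Defs
  imports Complex_Main "HOL-Algebra.IntRing" "HOL-Algebra.Chinese_Remainder"
begin

text \<open>
  The ring of integers modulo \<open>N\<close> is \<open>ZFact (int N)\<close>, the quotient of the integers by the ideal
  generated by \<open>N\<close>. Unlike \<open>residue_ring\<close>, it is a ring for \<open>N = 1\<close> as well.
\<close>

definition ideal_prob :: "('a, 'b) ring_scheme \<Rightarrow> real" where
  "ideal_prob R =
     real (card {I. ideal I R}) / real (card {H. subgroup H (add_monoid R)})"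

end

theory Submission
  imports Defs "HOL-Computational_Algebra.Primes"
begin

text \<open>
  A subgroup of $\mathbb{Z}_a \times \mathbb{Z}_b$ is the same thing as a subgroup of
  $\mathbb{Z} \times \mathbb{Z}$ that contains $a\mathbb{Z} \times b\mathbb{Z}$, and this
  correspondence preserves and reflects ideals. Such a subgroup $L$ has a unique basis
  $(d, t), (0, e)$ with $0 \le t < e$, its Hermite normal form: $d$ generates the projection of $L$
  to the first coordinate, $e$ generates the set of $y$ with $(0, y) \in L$, and $t$ is then
  determined modulo $e$. The condition that $L$ contains $(a, 0)$ and $(0, b)$ says that
  $d \mid a$, $e \mid b$ and $e \mid (a/d)t$. For fixed $d$ and $e$ there are $\gcd(a/d, e)$
  admissible values of $t$, and $d \mapsto a/d$ permutes the divisors of $a$, so the number of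
  subgroups is
  \[ \sum_{d \mid a} \sum_{e \mid b} \gcd(d, e). \]
  
  The subgroup $L$ is an ideal exactly when it is closed under multiplication by $(1, 0)$ and
  $(0, 1)$, that is, when $t = 0$. So the ideals are counted by pairs of a divisor of $a$ and a
  divisor of $b$, and \<open>ideal_prob_ZFact_pair\<close> expresses the probability through divisors alone.
  
  From here on the problem is arithmetic. Both counts are multiplicative with respect to coprime
  factors of $ab$, which splits the probability into a product over primes without decomposing the
  ring (\<open>ideal_ratio_prod_prime_powers\<close>). For a prime power the divisors are the powers of $p$,
  and the double sum becomes $\sum_{i \le r} \sum_{j \le s} p^{\min(i, j)}$. Its increments
  in $r$ and $s$ are geometric sums, which leads to the closed form
  \<open>power_min_sum_closed_form\<close> by induction.
\<close>

section \<open>Subgroups and ideals along a surjective ring homomorphism\<close>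

lemma (in ring_hom_ring) subgroup_vimage:
  assumes "subgroup K (add_monoid S)"
  shows "subgroup {x \<in> carrier R. h x \<in> K} (add_monoid R)"
proof (rule group.subgroupI[OF R.a_group])
  have "\<zero> \<in> {x \<in> carrier R. h x \<in> K}"
    using subgroup.one_closed[OF assms] by simp
  then show "{x \<in> carrier R. h x \<in> K} \<noteq> {}" by blast
next
  fix a assume "a \<in> {x \<in> carrier R. h x \<in> K}"
  then show "inv\<^bsub>add_monoid R\<^esub> a \<in> {x \<in> carrier R. h x \<in> K}"
    using subgroup.m_inv_closed[OF assms, of "h a"]
    by (simp flip: a_inv_def)
next
  fix a b assume "a \<in> {x \<in> carrier R. h x \<in> K}" "b \<in> {x \<in> carrier R. h x \<in> K}"
  then show "a \<otimes>\<^bsub>add_monoid R\<^esub> b \<in> {x \<in> carrier R. h x \<in> K}"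
    using subgroup.m_closed[OF assms, of "h a" "h b"] by simp
qed auto

text \<open>
  Two elements with the same image differ by an element of the kernel, and \<open>L\<close> absorbs the kernel.
\<close>

lemma (in ring_hom_ring) vimage_image_subgroup:
  assumes L: "subgroup L (add_monoid R)" and ker: "a_kernel R S h \<subseteq> L"
  shows "{x \<in> carrier R. h x \<in> h ` L} = L"
proof (intro subset_antisym subsetI)
  fix x assume "x \<in> {x \<in> carrier R. h x \<in> h ` L}"
  then obtain y where x: "x \<in> carrier R" and y: "y \<in> L" "h x = h y" by auto
  then have yR: "y \<in> carrier R" using subgroup.subset[OF L] by auto
  have "h (x \<ominus> y) = \<zero>\<^bsub>S\<^esub>"
    using x y(2) yR by (simp add: R.minus_eq S.r_neg)
  then have "x \<ominus> y \<in> a_kernel R S h"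
    using x yR unfolding a_kernel_def' by blast
  then have "(x \<ominus> y) \<oplus> y \<in> L"
    using subgroup.m_closed[OF L _ y(1), of "x \<ominus> y"] ker by auto
  moreover have "(x \<ominus> y) \<oplus> y = x" using x yR by (simp add: R.minus_eq R.a_assoc R.l_neg)
  ultimately show "x \<in> L" by simp
next
  fix x assume "x \<in> L"
  then show "x \<in> {x \<in> carrier R. h x \<in> h ` L}" using subgroup.subset[OF L] by auto
qed

text \<open>
  The correspondence theorem for the additive groups; taking preimages is the inverse map.
\<close>

lemma (in ring_hom_ring) bij_betw_subgroups_above_kernel:
  assumes surj: "h ` carrier R = carrier S"
  shows "bij_betw (image h)
           {L. subgroup L (add_monoid R) \<and> a_kernel R S h \<subseteq> L} {K. subgroup K (add_monoid S)}"
proof (rule bij_betw_byWitness[where f' = "\<lambda>K. {x \<in> carrier R. h x \<in> K}"])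
  show "\<forall>L\<in>{L. subgroup L (add_monoid R) \<and> a_kernel R S h \<subseteq> L}. {x \<in> carrier R. h x \<in> h ` L} = L"
    using vimage_image_subgroup by auto
  show "\<forall>K\<in>{K. subgroup K (add_monoid S)}. h ` {x \<in> carrier R. h x \<in> K} = K"
  proof
    fix K assume "K \<in> {K. subgroup K (add_monoid S)}"
    then have "K \<subseteq> h ` carrier R" using surj subgroup.subset by force
    then show "h ` {x \<in> carrier R. h x \<in> K} = K" by auto
  qed
  show "image h ` {L. subgroup L (add_monoid R) \<and> a_kernel R S h \<subseteq> L} \<subseteq> {K. subgroup K (add_monoid S)}"
    using img_is_add_subgroup by auto
  show "(\<lambda>K. {x \<in> carrier R. h x \<in> K}) ` {K. subgroup K (add_monoid S)}
          \<subseteq> {L. subgroup L (add_monoid R) \<and> a_kernel R S h \<subseteq> L}"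
  proof clarify
    fix K assume K: "subgroup K (add_monoid S)"
    have "\<zero>\<^bsub>S\<^esub> \<in> K" using subgroup.one_closed[OF K] by simp
    then have "a_kernel R S h \<subseteq> {x \<in> carrier R. h x \<in> K}"
      unfolding a_kernel_def' by auto
    then show "subgroup {x \<in> carrier R. h x \<in> K} (add_monoid R)
                 \<and> a_kernel R S h \<subseteq> {x \<in> carrier R. h x \<in> K}"
      using subgroup_vimage[OF K] by blast
  qed
qed

text \<open>
  The correspondence of subgroups restricts to one of ideals. The image of an ideal absorbs all of
  \<open>S\<close> because every element of \<open>S\<close> lifts to \<open>R\<close>; conversely \<open>L\<close> is the preimage of its image.
\<close>

lemma (in ring_hom_ring) ideal_image_iff:
  assumes surj: "h ` carrier R = carrier S"
    and L: "subgroup L (add_monoid R)" and ker: "a_kernel R S h \<subseteq> L"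
  shows "ideal (h ` L) S \<longleftrightarrow> ideal L R"
proof
  assume "ideal (h ` L) S"
  then show "ideal L R"
    using ideal_vimage vimage_image_subgroup[OF L ker] by metis
next
  assume I: "ideal L R"
  show "ideal (h ` L) S"
  proof (rule idealI[OF S.ring_axioms img_is_add_subgroup[OF L]])
    fix a x assume "a \<in> h ` L" "x \<in> carrier S"
    then obtain b y where b: "b \<in> L" "a = h b" and y: "y \<in> carrier R" "x = h y"
      using surj by blast
    have bR: "b \<in> carrier R" using b L subgroup.subset by force
    show "x \<otimes>\<^bsub>S\<^esub> a \<in> h ` L"
      using b y bR ideal.I_l_closed[OF I b(1) y(1)] by (metis hom_mult imageI)
    show "a \<otimes>\<^bsub>S\<^esub> x \<in> h ` L"
      using b y bR ideal.I_r_closed[OF I b(1) y(1)] by (metis hom_mult imageI)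
  qed
qed

section \<open>Pairs of residues as a quotient of pairs of integers\<close>

lemma subgroup_int_pairs_iff:
  "subgroup L (add_monoid (RDirProd \<Z> \<Z>)) \<longleftrightarrow>
     (0, 0) \<in> L \<and> (\<forall>x y x' y'. (x, y) \<in> L \<longrightarrow> (x', y') \<in> L \<longrightarrow> (x - x', y - y') \<in> L)"
    (is "?S \<longleftrightarrow> ?D")
proof -
  interpret ZZ: ring "RDirProd \<Z> \<Z>"
    by (rule RDirProd_ring[OF int.ring_axioms int.ring_axioms])
  have zero: "\<zero>\<^bsub>RDirProd \<Z> \<Z>\<^esub> = (0, 0)" by (simp add: RDirProd_def monoid.defs)
  have add: "(x, y) \<oplus>\<^bsub>RDirProd \<Z> \<Z>\<^esub> (x', y') = (x + x', y + y')" for x y x' y'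
    by (simp add: RDirProd_def monoid.defs)
  have inv: "inv\<^bsub>add_monoid (RDirProd \<Z> \<Z>)\<^esub> (x, y) = (- x, - y)" for x y :: int
    by (rule group.inv_equality[OF ZZ.a_group]) (auto simp: RDirProd_carrier zero add)
  show ?thesis
  proof
    assume L: ?S
    show ?D
    proof (intro conjI allI impI)
      show "(0, 0) \<in> L" using subgroup.one_closed[OF L] by (simp add: zero)
      fix x y x' y' assume "(x, y) \<in> L" "(x', y') \<in> L"
      then have "(x, y) \<otimes>\<^bsub>add_monoid (RDirProd \<Z> \<Z>)\<^esub> (- x', - y') \<in> L"
        using subgroup.m_closed[OF L] subgroup.m_inv_closed[OF L] inv by metis
      then show "(x - x', y - y') \<in> L" by (simp add: add)
    qed
  next
    assume D: ?D
    then have neg: "(- x, - y) \<in> L" if "(x, y) \<in> L" for x y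
      using that by (metis diff_0)
    show ?S
    proof (rule group.subgroupI[OF ZZ.a_group])
      show "L \<subseteq> carrier (add_monoid (RDirProd \<Z> \<Z>))" by (simp add: RDirProd_carrier)
      show "L \<noteq> {}" using D by auto
      show "inv\<^bsub>add_monoid (RDirProd \<Z> \<Z>)\<^esub> a \<in> L" if "a \<in> L" for a
        using that inv neg by (cases a) auto
      show "a \<otimes>\<^bsub>add_monoid (RDirProd \<Z> \<Z>)\<^esub> b \<in> L" if "a \<in> L" "b \<in> L" for a b
      proof (cases a, cases b)
        fix x y x' y' assume ab: "a = (x, y)" "b = (x', y')"
        then have "(x - - x', y - - y') \<in> L" using D neg that by blast
        then show ?thesis by (simp add: ab add)
      qed
    qed
  qed
qed

text \<open>
  The reduction map from $\mathbb{Z} \times \mathbb{Z}$ to $\mathbb{Z}_a \times \mathbb{Z}_b$;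
  in a quotient ring the residue of an integer is its coset.
\<close>

definition residue_pair :: "nat \<Rightarrow> nat \<Rightarrow> int \<times> int \<Rightarrow> int set \<times> int set" where
  "residue_pair a b = (\<lambda>(x, y). (Idl\<^bsub>\<Z>\<^esub> {int a} +>\<^bsub>\<Z>\<^esub> x, Idl\<^bsub>\<Z>\<^esub> {int b} +>\<^bsub>\<Z>\<^esub> y))"

lemma residue_pair_hom:
  "ring_hom_ring (RDirProd \<Z> \<Z>) (RDirProd (ZFact (int a)) (ZFact (int b))) (residue_pair a b)"
proof (rule ring_hom_ringI2)
  have h: "(+>\<^bsub>\<Z>\<^esub>) (Idl\<^bsub>\<Z>\<^esub> {k}) \<in> ring_hom \<Z> (ZFact k)" for k
    unfolding ZFact_def by (intro ideal.rcos_ring_hom int.genideal_ideal) simp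
  show "residue_pair a b \<in> ring_hom (RDirProd \<Z> \<Z>) (RDirProd (ZFact (int a)) (ZFact (int b)))"
    unfolding residue_pair_def by (rule RDirProd_hom3[OF h h])
  show "ring (RDirProd \<Z> \<Z>)"
    by (rule RDirProd_ring[OF int.ring_axioms int.ring_axioms])
  show "ring (RDirProd (ZFact (int a)) (ZFact (int b)))"
    by (intro RDirProd_ring cring.axioms(1) ZFact_is_cring)
qed

lemma residue_pair_surj:
  "residue_pair a b ` carrier (RDirProd \<Z> \<Z>) = carrier (RDirProd (ZFact (int a)) (ZFact (int b)))"
  by (auto simp: RDirProd_carrier residue_pair_def ZFact_def FactRing_def A_RCOSETS_def' image_iff)

lemma residue_pair_kernel:
  "a_kernel (RDirProd \<Z> \<Z>) (RDirProd (ZFact (int a)) (ZFact (int b))) (residue_pair a b)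
     = {(x, y). int a dvd x \<and> int b dvd y}"
proof -
  have z: "\<zero>\<^bsub>RDirProd (ZFact (int a)) (ZFact (int b))\<^esub> = (Idl\<^bsub>\<Z>\<^esub> {int a}, Idl\<^bsub>\<Z>\<^esub> {int b})"
    by (simp add: RDirProd_def monoid.defs ZFact_def FactRing_def)
  have c: "Idl\<^bsub>\<Z>\<^esub> {k} +>\<^bsub>\<Z>\<^esub> x = Idl\<^bsub>\<Z>\<^esub> {k} \<longleftrightarrow> k dvd x" for k x
  proof -
    interpret I: ideal "Idl\<^bsub>\<Z>\<^esub> {k}" \<Z> by (rule int.genideal_ideal) simp
    have "Idl\<^bsub>\<Z>\<^esub> {k} +>\<^bsub>\<Z>\<^esub> x = Idl\<^bsub>\<Z>\<^esub> {k} \<longleftrightarrow> x \<in> Idl\<^bsub>\<Z>\<^esub> {k}"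
      using I.a_rcos_self[of x] I.a_rcos_const[of x] by auto
    then show ?thesis by (auto simp: int_Idl dvd_def)
  qed
  have "residue_pair a b (x, y) = \<zero>\<^bsub>RDirProd (ZFact (int a)) (ZFact (int b))\<^esub>
          \<longleftrightarrow> int a dvd x \<and> int b dvd y" for x y
    unfolding z residue_pair_def prod.case prod.inject c ..
  then show ?thesis
    unfolding a_kernel_def' by (auto simp: RDirProd_carrier)
qed

section \<open>Hermite normal forms\<close>

text \<open>
  The subgroup of $\mathbb{Z} \times \mathbb{Z}$ generated by $(d, t)$ and $(0, e)$.
\<close>

definition hnf_lattice :: "nat \<Rightarrow> nat \<Rightarrow> nat \<Rightarrow> (int \<times> int) set" where
  "hnf_lattice d e t = {(int d * u, int t * u + int e * v) |u v. True}"

text \<open>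
  The triples whose lattice contains $a\mathbb{Z} \times b\mathbb{Z}$, with \<open>t\<close> reduced modulo \<open>e\<close>
  so that each lattice arises from one triple only.
\<close>

definition hnf_params :: "nat \<Rightarrow> nat \<Rightarrow> (nat \<times> nat \<times> nat) set" where
  "hnf_params a b =
     (SIGMA d:{d. d dvd a}. SIGMA e:{e. e dvd b}. {t. t < e \<and> e dvd a div d * t})"

text \<open>
  Division with remainder by the least positive element shows that it divides all others. The
  positive element \<open>a\<close> guarantees that it exists, and makes the generator a divisor of \<open>a\<close>.
\<close>

lemma int_subgroup_principal:
  fixes S :: "int set"
  assumes diff: "\<And>x y. x \<in> S \<Longrightarrow> y \<in> S \<Longrightarrow> x - y \<in> S" and a: "int a \<in> S" "a > 0"
  shows "\<exists>d. d dvd a \<and> S = {x. int d dvd x}"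
proof -
  have zero: "0 \<in> S" using diff[OF a(1) a(1)] by simp
  have add: "x + y \<in> S" if "x \<in> S" "y \<in> S" for x y
    using diff[OF that(1) diff[OF zero that(2)]] by simp
  have smult: "x * k \<in> S" if "x \<in> S" for x k
  proof (induction k rule: int_induct[where k = 0])
    case base then show ?case using zero by simp
  next
    case (step1 i)
    from add[OF step1(2) that] show ?case by (simp add: algebra_simps)
  next
    case (step2 i)
    from diff[OF step2(2) that] show ?case by (simp add: algebra_simps)
  qed
  define d where "d = (LEAST d. d > 0 \<and> int d \<in> S)"
  have d: "d > 0" "int d \<in> S"
    using LeastI[of "\<lambda>d. d > 0 \<and> int d \<in> S" a] a unfolding d_def by auto
  have min: "d \<le> k" if "k > 0" "int k \<in> S" for k
    unfolding d_def using that by (intro Least_le) auto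
  have S: "S = {x. int d dvd x}"
  proof (intro subset_antisym subsetI)
    fix x assume "x \<in> S"
    then have "x - int d * (x div int d) \<in> S" using diff smult d by blast
    then have m: "x mod int d \<in> S" by (simp add: minus_mult_div_eq_mod)
    define k where "k = nat (x mod int d)"
    have k: "int k = x mod int d" using d(1) by (simp add: k_def)
    then have "int k < int d" using d(1) by simp
    then have "\<not> 0 < k" using min[of k] m by (auto simp flip: k)
    then have "x mod int d = 0" using k by simp
    then show "x \<in> {x. int d dvd x}" by auto
  next
    fix x assume "x \<in> {x. int d dvd x}"
    then show "x \<in> S" using smult d by auto
  qed
  then have "d dvd a" using a by auto
  with S show ?thesis by blast
qed

lemma hnf_lattice_subgroup: "subgroup (hnf_lattice d e t) (add_monoid (RDirProd \<Z> \<Z>))"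
  unfolding subgroup_int_pairs_iff hnf_lattice_def
proof (intro conjI allI impI)
  show "(0, 0) \<in> {(int d * u, int t * u + int e * v) |u v. True}"
    by (auto intro!: exI[of _ 0])
  fix x y x' y'
  assume "(x, y) \<in> {(int d * u, int t * u + int e * v) |u v. True}"
    and "(x', y') \<in> {(int d * u, int t * u + int e * v) |u v. True}"
  then obtain u v u' v' where "x = int d * u" "y = int t * u + int e * v"
    "x' = int d * u'" "y' = int t * u' + int e * v'" by blast
  then have "x - x' = int d * (u - u')" "y - y' = int t * (u - u') + int e * (v - v')"
    by (auto simp: algebra_simps)
  then show "(x - x', y - y') \<in> {(int d * u, int t * u + int e * v) |u v. True}" by blast
qed

lemma mem_hnf_lattice_iff:
  assumes "d > 0"
  shows "(x, y) \<in> hnf_lattice d e t \<longleftrightarrow> int d dvd x \<and> int e dvd y - int t * (x div int d)"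
proof
  assume "(x, y) \<in> hnf_lattice d e t"
  then show "int d dvd x \<and> int e dvd y - int t * (x div int d)"
    using assms by (auto simp: hnf_lattice_def)
next
  assume "int d dvd x \<and> int e dvd y - int t * (x div int d)"
  then obtain v where "x = int d * (x div int d)" "y - int t * (x div int d) = int e * v"
    by (auto elim!: dvdE)
  then have "x = int d * (x div int d)" "y = int t * (x div int d) + int e * v" by linarith+
  then show "(x, y) \<in> hnf_lattice d e t" unfolding hnf_lattice_def by blast
qed

text \<open>
  The kernel is generated by $(a, 0)$ and $(0, b)$. The first of them lies in the lattice when
  $(a, 0) - (a/d)(d, t) = (0, -(a/d)t)$ is a multiple of $(0, e)$, the second when $e \mid b$.
\<close>

lemma kernel_le_hnf_lattice_iff:
  assumes "d > 0" "d dvd a"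
  shows "{(x, y). int a dvd x \<and> int b dvd y} \<subseteq> hnf_lattice d e t \<longleftrightarrow>
           e dvd b \<and> e dvd a div d * t" (is "?K \<subseteq> _ \<longleftrightarrow> _")
proof
  assume "?K \<subseteq> hnf_lattice d e t"
  moreover have "(0, int b) \<in> ?K" "(int a, 0) \<in> ?K" by simp_all
  ultimately have "(0, int b) \<in> hnf_lattice d e t" "(int a, 0) \<in> hnf_lattice d e t" by blast+
  then have "int e dvd int b" "int e dvd int t * (int a div int d)"
    using assms by (auto simp: mem_hnf_lattice_iff)
  then have "int e dvd int b" "int e dvd int (a div d * t)"
    by (simp_all add: zdiv_int mult.commute)
  then show "e dvd b \<and> e dvd a div d * t" by (simp only: of_nat_dvd_iff)
next
  assume e: "e dvd b \<and> e dvd a div d * t"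
  show "?K \<subseteq> hnf_lattice d e t"
  proof clarify
    fix x y assume x: "int a dvd x" and y: "int b dvd y"
    then obtain k where k: "x = int a * k" by blast
    have "int e dvd int (a div d * t)" using e by (simp only: of_nat_dvd_iff)
    then have "int e dvd int t * (int a div int d) * k"
      by (simp add: zdiv_int mult.commute)
    moreover have "x div int d = int a div int d * k"
      using assms k by (auto simp: dvd_def)
    moreover have "int e dvd y" using e y by (meson dvd_trans of_nat_dvd_iff)
    moreover have "int d dvd x" using assms k by auto
    ultimately show "(x, y) \<in> hnf_lattice d e t"
      using assms by (simp add: mem_hnf_lattice_iff mult.assoc)
  qed
qed

text \<open>
  Each of the two lattices contains the generators of the other, so \<open>d\<close> and \<open>d'\<close> divide each other,
  as do \<open>e\<close> and \<open>e'\<close>. Then \<open>t\<close> and \<open>t'\<close> are congruent modulo \<open>e\<close> and both reduced.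
\<close>

lemma hnf_lattice_inj:
  assumes eq: "hnf_lattice d e t = hnf_lattice d' e' t'"
    and pos: "d > 0" "d' > 0" and t: "t < e" "t' < e'"
  shows "d = d' \<and> e = e' \<and> t = t'"
proof -
  have "(int d, int t) \<in> hnf_lattice d e t" "(int d', int t') \<in> hnf_lattice d' e' t'"
    using pos by (simp_all add: mem_hnf_lattice_iff)
  then have "(int d, int t) \<in> hnf_lattice d' e' t'" "(int d', int t') \<in> hnf_lattice d e t"
    using eq by simp_all
  then have dd: "d' dvd d" "d dvd d'" and "int e dvd int t' - int t * (int d' div int d)"
    using pos by (simp_all add: mem_hnf_lattice_iff)
  then have d: "d = d'" and tt: "int e dvd int t' - int t"
    using pos dvd_antisym[OF dd] by simp_all
  have "(0, int e) \<in> hnf_lattice d e t" "(0, int e') \<in> hnf_lattice d' e' t'"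
    using pos by (simp_all add: mem_hnf_lattice_iff)
  then have "(0, int e) \<in> hnf_lattice d' e' t'" "(0, int e') \<in> hnf_lattice d e t"
    using eq by simp_all
  then have "e' dvd e" "e dvd e'"
    using pos by (simp_all add: mem_hnf_lattice_iff)
  then have e: "e = e'" by (rule dvd_antisym[rotated])
  have "t = t'"
  proof -
    have "int t mod int e = int t' mod int e"
      using tt by (metis mod_eq_dvd_iff)
    then show ?thesis using t e by simp
  qed
  with d e show ?thesis by simp
qed

text \<open>
  Both the projection of \<open>L\<close> to the first coordinate and the intersection of \<open>L\<close> with the second
  coordinate axis are nonzero subgroups of the integers, hence generated by some \<open>d\<close> and \<open>e\<close>. An
  element of \<open>L\<close> above \<open>d\<close> can be reduced by multiples of $(0, e)$, and subtracting multiples of it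
  brings any element of \<open>L\<close> to the axis.
\<close>

lemma exists_hnf_lattice:
  assumes L: "subgroup L (add_monoid (RDirProd \<Z> \<Z>))"
    and ker: "{(x, y). int a dvd x \<and> int b dvd y} \<subseteq> L" and pos: "a > 0" "b > 0"
  obtains d e t where "d dvd a" "e dvd b" "t < e" "L = hnf_lattice d e t"
proof -
  have zero: "(0, 0) \<in> L"
    and diff: "\<And>x y x' y'. (x, y) \<in> L \<Longrightarrow> (x', y') \<in> L \<Longrightarrow> (x - x', y - y') \<in> L"
    using L[unfolded subgroup_int_pairs_iff] by blast+
  have "\<exists>d. d dvd a \<and> fst ` L = {x. int d dvd x}"
  proof (rule int_subgroup_principal[of "fst ` L" a])
    fix x y assume "x \<in> fst ` L" "y \<in> fst ` L"
    then obtain x' y' where "(x, x') \<in> L" "(y, y') \<in> L" by auto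
    from diff[OF this] show "x - y \<in> fst ` L" by (rule image_eqI[rotated]) simp
  next
    have "(int a, 0) \<in> L" by (rule subsetD[OF ker]) simp
    then show "int a \<in> fst ` L" by (rule image_eqI[rotated]) simp
  qed (rule pos)
  then obtain d where d: "d dvd a" "fst ` L = {x. int d dvd x}" by blast
  have "\<exists>e. e dvd b \<and> {y. (0, y) \<in> L} = {y. int e dvd y}"
  proof (rule int_subgroup_principal[of "{y. (0, y) \<in> L}" b])
    show "x - y \<in> {y. (0, y) \<in> L}" if "x \<in> {y. (0, y) \<in> L}" "y \<in> {y. (0, y) \<in> L}" for x y
      using that diff[of 0 x 0 y] by simp
    have "(0, int b) \<in> L" by (rule subsetD[OF ker]) simp
    then show "int b \<in> {y. (0, y) \<in> L}" by simp
  qed (rule pos)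
  then obtain e where e: "e dvd b" "{y. (0, y) \<in> L} = {y. int e dvd y}" by blast
  have dpos: "d > 0" and epos: "e > 0" using d e pos by (auto intro: Nat.gr0I)
  have L0: "(0, z) \<in> L \<longleftrightarrow> int e dvd z" for z using e(2) by (simp add: set_eq_iff)
  have "int d \<in> fst ` L" unfolding d(2) by simp
  then obtain w where w: "(int d, w) \<in> L" by auto
  define t where "t = nat (w mod int e)"
  have tw: "int t = w - int e * (w div int e)"
    using epos by (simp add: t_def minus_mult_div_eq_mod)
  have t: "(int d, int t) \<in> L"
  proof -
    have "(0, int e * (w div int e)) \<in> L" by (simp add: L0)
    from diff[OF w this] show ?thesis by (simp add: tw)
  qed
  have te: "t < e"
    unfolding t_def using epos pos_mod_bound[of "int e" w] by (simp add: nat_less_iff)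
  have tu: "(int d * u, int t * u) \<in> L" for u
  proof (induction u rule: int_induct[where k = 0])
    case base then show ?case using zero by simp
  next
    case (step1 i)
    from diff[OF step1(2) diff[OF zero t]] show ?case by (simp add: algebra_simps)
  next
    case (step2 i)
    from diff[OF step2(2) t] show ?case by (simp add: algebra_simps)
  qed
  have "(x, y) \<in> L \<longleftrightarrow> (x, y) \<in> hnf_lattice d e t" for x y
  proof -
    have "(x, y) \<in> L \<longleftrightarrow> (0, y - int t * u) \<in> L" if "x = int d * u" for u
    proof
      assume "(x, y) \<in> L"
      from diff[OF this tu[of u]] show "(0, y - int t * u) \<in> L" using that by simp
    next
      assume "(0, y - int t * u) \<in> L"
      from diff[OF this tu[of "- u"]] show "(x, y) \<in> L" using that by simp
    qed
    moreover have "int d dvd x" if "(x, y) \<in> L"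
    proof -
      have "x \<in> fst ` L" using that by (rule image_eqI[rotated]) simp
      then show ?thesis unfolding d(2) by simp
    qed
    ultimately show ?thesis
      using dpos unfolding mem_hnf_lattice_iff[OF dpos] L0 by (metis dvd_mult_div_cancel)
  qed
  then have "L = hnf_lattice d e t" by auto
  with d(1) e(1) te show thesis using that by blast
qed

lemma bij_betw_hnf_lattice:
  assumes pos: "a > 0" "b > 0"
  shows "bij_betw (\<lambda>(d, e, t). hnf_lattice d e t) (hnf_params a b)
           {L. subgroup L (add_monoid (RDirProd \<Z> \<Z>)) \<and> {(x, y). int a dvd x \<and> int b dvd y} \<subseteq> L}"
    (is "bij_betw _ _ ?Ls")
proof -
  have dpos: "d > 0" if "d dvd a" for d using that pos by (auto intro: Nat.gr0I)
  have "inj_on (\<lambda>(d, e, t). hnf_lattice d e t) (hnf_params a b)"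
    unfolding hnf_params_def by (intro inj_onI) (use hnf_lattice_inj dpos in auto)
  moreover have "(\<lambda>(d, e, t). hnf_lattice d e t) ` hnf_params a b = ?Ls"
  proof (intro subset_antisym subsetI)
    fix L assume "L \<in> (\<lambda>(d, e, t). hnf_lattice d e t) ` hnf_params a b"
    then obtain d e t where p: "d dvd a" "e dvd b" "e dvd a div d * t" and L: "L = hnf_lattice d e t"
      unfolding hnf_params_def by auto
    have "{(x, y). int a dvd x \<and> int b dvd y} \<subseteq> L"
      unfolding L using p kernel_le_hnf_lattice_iff[OF dpos[OF p(1)] p(1)] by blast
    then show "L \<in> ?Ls"
      unfolding L using hnf_lattice_subgroup by blast
  next
    fix L assume "L \<in> ?Ls"
    then obtain d e t where *: "d dvd a" "e dvd b" "t < e" "L = hnf_lattice d e t"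
      and ker: "{(x, y). int a dvd x \<and> int b dvd y} \<subseteq> L"
      using exists_hnf_lattice[of L a b, OF _ _ pos] by (metis (no_types, lifting) mem_Collect_eq)
    have "e dvd a div d * t"
      using ker kernel_le_hnf_lattice_iff[OF dpos[OF *(1)] *(1), of b e t] unfolding *(4) by simp
    with * have "(d, e, t) \<in> hnf_params a b" by (simp add: hnf_params_def)
    then show "L \<in> (\<lambda>(d, e, t). hnf_lattice d e t) ` hnf_params a b"
      by (rule image_eqI[rotated]) (simp add: *(4))
  qed
  ultimately show ?thesis by (simp add: bij_betw_def)
qed

text \<open>
  Multiplying the generator $(d, t)$ by $(0, 1)$ gives $(0, t)$, which lies in the lattice only if
  $e \mid t$. For $t = 0$ the lattice is the ideal $d\mathbb{Z} \times e\mathbb{Z}$.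
\<close>

lemma hnf_lattice_ideal_iff:
  assumes "d > 0" "t < e"
  shows "ideal (hnf_lattice d e t) (RDirProd \<Z> \<Z>) \<longleftrightarrow> t = 0"
proof
  assume "ideal (hnf_lattice d e t) (RDirProd \<Z> \<Z>)"
  moreover have "(int d, int t) \<in> hnf_lattice d e t"
    using assms by (simp add: mem_hnf_lattice_iff)
  ultimately have "(0, 1) \<otimes>\<^bsub>RDirProd \<Z> \<Z>\<^esub> (int d, int t) \<in> hnf_lattice d e t"
    by (intro ideal.I_l_closed) (auto simp: RDirProd_carrier)
  then have "(0, int t) \<in> hnf_lattice d e t"
    by (simp add: RDirProd_def monoid.defs)
  then have "e dvd t" using assms by (simp add: mem_hnf_lattice_iff)
  then show "t = 0" using assms by (auto dest: dvd_imp_le)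
next
  assume [simp]: "t = 0"
  show "ideal (hnf_lattice d e t) (RDirProd \<Z> \<Z>)"
    by (rule idealI[OF RDirProd_ring[OF int.ring_axioms int.ring_axioms] hnf_lattice_subgroup])
      (use assms in \<open>auto simp: mem_hnf_lattice_iff RDirProd_def monoid.defs\<close>)
qed

section \<open>Counting subgroups and ideals by divisors\<close>

text \<open>
  The number of Hermite normal forms, hence of subgroups of $\mathbb{Z}_a \times \mathbb{Z}_b$.
\<close>

definition gcd_sum :: "nat \<Rightarrow> nat \<Rightarrow> nat" where
  "gcd_sum a b = (\<Sum>d | d dvd a. \<Sum>e | e dvd b. gcd d e)"

text \<open>
  The value of \<open>ideal_prob\<close> on $\mathbb{Z}_a \times \mathbb{Z}_b$: the ideals of this ring are
  the products of an ideal of each factor.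
\<close>

definition ideal_ratio :: "nat \<Rightarrow> nat \<Rightarrow> real" where
  "ideal_ratio a b = real (card {d. d dvd a}) * real (card {e. e dvd b}) / real (gcd_sum a b)"

text \<open>
  After division by $g = \gcd(c, e)$ the condition says that $e/g$ divides $t$, and there are $g$
  multiples of $e/g$ below $e$.
\<close>

lemma card_linear_solutions:
  fixes c e :: nat
  assumes "e > 0"
  shows "card {t. t < e \<and> e dvd c * t} = gcd c e"
proof -
  define g where "g = gcd c e"
  obtain c' e' where c': "c = c' * g" and e': "e = e' * g" and cop: "coprime c' e'"
    using gcd_coprime_exists[of c e] assms unfolding g_def by auto
  have g: "g > 0" "e' > 0" using assms e' by (auto intro: Nat.gr0I)
  have "e dvd c * t \<longleftrightarrow> e' dvd t" for t
  proof -
    have "e dvd c * t \<longleftrightarrow> e' dvd c' * t"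
      using g by (simp add: c' e' mult.commute mult.left_commute)
    also have "\<dots> \<longleftrightarrow> e' dvd t"
      using cop by (simp add: coprime_dvd_mult_right_iff coprime_commute)
    finally show ?thesis .
  qed
  then have "{t. t < e \<and> e dvd c * t} = (\<lambda>k. e' * k) ` {..<g}"
    using g by (auto simp: e' image_iff elim!: dvdE)
  moreover have "inj_on (\<lambda>k. e' * k) {..<g}" using g by (auto intro: inj_onI)
  ultimately show ?thesis by (simp add: card_image g_def)
qed

lemma sum_divisors_reflect:
  fixes a :: nat
  assumes "a > 0"
  shows "(\<Sum>d | d dvd a. f (a div d)) = (\<Sum>d | d dvd a. f d)"
proof -
  have "a div d dvd a \<and> a div (a div d) = d" if d: "d dvd a" for d
  proof -
    obtain k where k: "a = d * k" using d by (rule dvdE)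
    then have "d > 0" "k > 0" using assms by simp_all
    then show ?thesis by (simp add: k)
  qed
  then show ?thesis
    by (intro sum.reindex_bij_witness[of _ "\<lambda>d. a div d" "\<lambda>d. a div d"]) simp_all
qed

lemma card_hnf_params:
  assumes "a > 0" "b > 0"
  shows "card (hnf_params a b) = gcd_sum a b"
proof -
  have fin: "finite {d. d dvd a}" "finite {e. e dvd b}" using assms by simp_all
  have epos: "e > 0" if "e dvd b" for e using that assms by (auto intro: Nat.gr0I)
  have "card (hnf_params a b)
          = (\<Sum>d | d dvd a. \<Sum>e | e dvd b. card {t. t < e \<and> e dvd a div d * t})"
    unfolding hnf_params_def using fin by (simp add: card_SigmaI)
  also have "\<dots> = (\<Sum>d | d dvd a. \<Sum>e | e dvd b. gcd (a div d) e)"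
    by (intro sum.cong refl card_linear_solutions) (use epos in auto)
  also have "\<dots> = gcd_sum a b"
    unfolding gcd_sum_def
    by (rule sum_divisors_reflect[OF assms(1), where f = "\<lambda>c. \<Sum>e | e dvd b. gcd c e"])
  finally show ?thesis .
qed

text \<open>
  The map \<open>\<Phi>\<close> parametrizes the subgroups of the quotient ring by Hermite normal forms. The ideals
  among them are the images of the set \<open>T\<close> of forms with last entry zero, which are free pairs of
  divisors, since $e \mid (a/d) \cdot 0$ always holds.
\<close>

lemma ideal_prob_ZFact_pair:
  assumes pos: "a > 0" "b > 0"
  shows "ideal_prob (RDirProd (ZFact (int a)) (ZFact (int b))) = ideal_ratio a b"
proof -
  define R where "R = RDirProd (ZFact (int a)) (ZFact (int b))"
  interpret h: ring_hom_ring "RDirProd \<Z> \<Z>" R "residue_pair a b"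
    unfolding R_def by (rule residue_pair_hom)
  define \<Phi> where "\<Phi> = image (residue_pair a b) \<circ> (\<lambda>(d, e, t). hnf_lattice d e t)"
  have ker: "a_kernel (RDirProd \<Z> \<Z>) R (residue_pair a b) = {(x, y). int a dvd x \<and> int b dvd y}"
    unfolding R_def by (rule residue_pair_kernel)
  have surj: "residue_pair a b ` carrier (RDirProd \<Z> \<Z>) = carrier R"
    unfolding R_def by (rule residue_pair_surj)
  have bij: "bij_betw \<Phi> (hnf_params a b) {K. subgroup K (add_monoid R)}"
    unfolding \<Phi>_def
    by (rule bij_betw_trans[OF bij_betw_hnf_lattice[OF pos]
          h.bij_betw_subgroups_above_kernel[OF surj, unfolded ker]])
  define T where "T = {(d, e, t). d dvd a \<and> e dvd b \<and> t = (0 :: nat)}"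
  have T: "T = (\<lambda>(d, e). (d, e, 0)) ` ({d. d dvd a} \<times> {e. e dvd b})"
    unfolding T_def by auto
  have "card T = card ({d. d dvd a} \<times> {e. e dvd b})"
    unfolding T by (rule card_image) (auto intro: inj_onI)
  then have card_T: "card T = card {d. d dvd a} * card {e. e dvd b}" by (simp add: card_cartesian_product)
  have sub: "T \<subseteq> hnf_params a b"
    using pos by (auto simp: T_def hnf_params_def intro: Nat.gr0I)
  have ideal: "ideal (\<Phi> p) R \<longleftrightarrow> p \<in> T" if p: "p \<in> hnf_params a b" for p
  proof -
    obtain d e t where p_eq: "p = (d, e, t)" by (cases p)
    have d: "d dvd a" and e: "e dvd b" and t: "t < e" "e dvd a div d * t"
      using p unfolding p_eq hnf_params_def by auto
    have dpos: "d > 0" using d pos by (auto intro: Nat.gr0I)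
    have "{(x, y). int a dvd x \<and> int b dvd y} \<subseteq> hnf_lattice d e t"
      using kernel_le_hnf_lattice_iff[OF dpos d] e t by blast
    then have "ideal (residue_pair a b ` hnf_lattice d e t) R
                 \<longleftrightarrow> ideal (hnf_lattice d e t) (RDirProd \<Z> \<Z>)"
      by (intro h.ideal_image_iff[OF surj hnf_lattice_subgroup]) (simp only: ker)
    then show ?thesis
      using hnf_lattice_ideal_iff[OF dpos t(1)] d e by (simp add: p_eq \<Phi>_def T_def)
  qed
  have "{I. ideal I R} = \<Phi> ` T"
  proof (intro subset_antisym subsetI)
    fix I assume "I \<in> {I. ideal I R}"
    then have I: "ideal I R" by simp
    then have "I \<in> {K. subgroup K (add_monoid R)}"
      using additive_subgroup.a_subgroup ideal.axioms(1) by blast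
    then obtain p where "p \<in> hnf_params a b" "I = \<Phi> p"
      using bij unfolding bij_betw_def by blast
    then show "I \<in> \<Phi> ` T" using ideal I by blast
  qed (use ideal sub in auto)
  moreover have "inj_on \<Phi> T" using bij sub by (meson bij_betw_def inj_on_subset)
  ultimately have "card {I. ideal I R} = card {d. d dvd a} * card {e. e dvd b}"
    by (simp add: card_image card_T)
  moreover have "card {K. subgroup K (add_monoid R)} = gcd_sum a b"
    using bij_betw_same_card[OF bij] card_hnf_params[OF pos] by simp
  ultimately show ?thesis
    unfolding ideal_prob_def ideal_ratio_def R_def by (simp only: of_nat_mult)
qed

section \<open>Multiplicativity\<close>

lemma bij_betw_divisors_coprime:
  fixes a b :: nat
  assumes "coprime a b"
  shows "bij_betw (\<lambda>(d, e). d * e) ({d. d dvd a} \<times> {e. e dvd b}) {c. c dvd a * b}"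
proof -
  have "d = d' \<and> e = e'"
    if "d dvd a" "e dvd b" "d' dvd a" "e' dvd b" "d * e = d' * e'" for d e d' e'
  proof -
    have "coprime d e'" "coprime d' e"
      using that assms by (meson coprime_divisors)+
    then show ?thesis using that(5) coprime_crossproduct_nat by (metis coprime_commute mult.commute)
  qed
  then have "inj_on (\<lambda>(d, e). d * e) ({d. d dvd a} \<times> {e. e dvd b})"
    by (auto intro!: inj_onI)
  moreover have "(\<lambda>(d, e). d * e) ` ({d. d dvd a} \<times> {e. e dvd b}) = {c. c dvd a * b}"
  proof (intro subset_antisym subsetI)
    fix c assume "c \<in> {c. c dvd a * b}"
    then obtain d e where "c = d * e" "d dvd a" "e dvd b"
      using division_decomp[of c a b] by auto
    then show "c \<in> (\<lambda>(d, e). d * e) ` ({d. d dvd a} \<times> {e. e dvd b})" by auto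
  qed (auto intro: mult_dvd_mono)
  ultimately show ?thesis by (simp add: bij_betw_def)
qed

lemma sum_divisors_coprime:
  fixes a b :: nat
  assumes "coprime a b"
  shows "(\<Sum>c | c dvd a * b. f c) = (\<Sum>d | d dvd a. \<Sum>e | e dvd b. f (d * e))"
proof -
  have "(\<Sum>c | c dvd a * b. f c) = (\<Sum>(d, e) \<in> {d. d dvd a} \<times> {e. e dvd b}. f (d * e))"
    using sum.reindex_bij_betw[OF bij_betw_divisors_coprime[OF assms], of f]
    by (simp add: case_prod_unfold)
  then show ?thesis by (simp add: sum.cartesian_product)
qed

text \<open>
  Dividing out $\gcd(d, e)$ and $\gcd(d', e')$ leaves four cofactors. Each cofactor of \<open>d\<close> and \<open>d'\<close>
  is then coprime to each cofactor of \<open>e\<close> and \<open>e'\<close>.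
\<close>

lemma gcd_mult_coprime:
  fixes d d' e e' :: nat
  assumes "coprime (d * e) (d' * e')"
  shows "gcd (d * d') (e * e') = gcd d e * gcd d' e'"
proof (cases "gcd d e = 0 \<or> gcd d' e' = 0")
  case True
  then show ?thesis using assms by auto
next
  case False
  obtain x y where x: "d = x * gcd d e" "e = y * gcd d e" "coprime x y"
    using gcd_coprime_exists False by metis
  obtain x' y' where x': "d' = x' * gcd d' e'" "e' = y' * gcd d' e'" "coprime x' y'"
    using gcd_coprime_exists False by metis
  define g where "g = gcd d e"
  define g' where "g' = gcd d' e'"
  have d: "d = x * g" "e = y * g" "d' = x' * g'" "e' = y' * g'"
    using x x' unfolding g_def g'_def by auto
  have "coprime x y'" "coprime x' y"
    using assms unfolding d by (auto simp: coprime_commute)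
  then have "coprime (x * x') (y * y')" using x(3) x'(3) by (auto simp: coprime_commute)
  then have "gcd (g * g' * (x * x')) (g * g' * (y * y')) = g * g'"
    by (simp flip: gcd_mult_distrib_nat)
  moreover have "d * d' = g * g' * (x * x')" "e * e' = g * g' * (y * y')"
    unfolding d by (simp_all add: ac_simps)
  ultimately show ?thesis unfolding g_def g'_def by simp
qed

lemma gcd_sum_mult_coprime:
  assumes "coprime (a * b) (a' * b')"
  shows "gcd_sum (a * a') (b * b') = gcd_sum a b * gcd_sum a' b'"
proof -
  have "coprime a a'" "coprime b b'" using assms by auto
  then have "gcd_sum (a * a') (b * b') =
      (\<Sum>d | d dvd a. \<Sum>d' | d' dvd a'. \<Sum>e | e dvd b. \<Sum>e' | e' dvd b'. gcd (d * d') (e * e'))"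
    unfolding gcd_sum_def by (simp add: sum_divisors_coprime)
  also have "\<dots> =
      (\<Sum>d | d dvd a. \<Sum>d' | d' dvd a'. \<Sum>e | e dvd b. \<Sum>e' | e' dvd b'. gcd d e * gcd d' e')"
  proof (intro sum.cong refl gcd_mult_coprime)
    fix d d' e e' assume "d \<in> {d. d dvd a}" "d' \<in> {d. d dvd a'}" "e \<in> {e. e dvd b}" "e' \<in> {e. e dvd b'}"
    then have "d * e dvd a * b" "d' * e' dvd a' * b'" by (simp_all add: mult_dvd_mono)
    then show "coprime (d * e) (d' * e')" using assms by (meson coprime_divisors)
  qed
  also have "\<dots> = (\<Sum>d | d dvd a. \<Sum>d' | d' dvd a'.
                     (\<Sum>e | e dvd b. gcd d e) * (\<Sum>e' | e' dvd b'. gcd d' e'))"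
    by (simp add: sum_product)
  also have "\<dots> = gcd_sum a b * gcd_sum a' b'"
    unfolding gcd_sum_def by (simp add: sum_product)
  finally show ?thesis .
qed

lemma ideal_ratio_mult_coprime:
  assumes "coprime (a * b) (a' * b')"
  shows "ideal_ratio (a * a') (b * b') = ideal_ratio a b * ideal_ratio a' b'"
proof -
  have "card {d. d dvd x * y} = card {d. d dvd x} * card {d. d dvd y}"
    if "coprime x y" for x y :: nat
    using bij_betw_same_card[OF bij_betw_divisors_coprime[OF that]]
    by (simp add: card_cartesian_product)
  moreover have "coprime a a'" "coprime b b'" using assms by auto
  ultimately show ?thesis
    using gcd_sum_mult_coprime[OF assms] by (simp add: ideal_ratio_def)
qed

lemma ideal_ratio_prod_prime_powers:
  fixes p s r :: "nat \<Rightarrow> nat"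
  assumes "finite I" "inj_on p I" "\<And>i. i \<in> I \<Longrightarrow> prime (p i)"
  shows "ideal_ratio (\<Prod>i\<in>I. p i ^ s i) (\<Prod>i\<in>I. p i ^ r i)
           = (\<Prod>i\<in>I. ideal_ratio (p i ^ s i) (p i ^ r i))"
  using assms
proof (induction I rule: finite_induct)
  case empty
  then show ?case by (simp add: ideal_ratio_def gcd_sum_def)
next
  case (insert i I)
  have "coprime (p i) (p j)" if "j \<in> I" for j
    using insert that by (intro primes_coprime) (auto simp: inj_on_def)
  then have "coprime (p i ^ s i * p i ^ r i) ((\<Prod>j\<in>I. p j ^ s j) * (\<Prod>j\<in>I. p j ^ r j))"
    by (auto intro!: prod_coprime_right)
  then show ?case
    using insert by (simp add: ideal_ratio_mult_coprime)
qed

section \<open>Prime powers\<close>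

text \<open>
  The value of \<open>gcd_sum\<close> at two powers of a prime, in terms of the exponents.
\<close>

definition power_min_sum :: "nat \<Rightarrow> nat \<Rightarrow> nat \<Rightarrow> nat" where
  "power_min_sum p s r = (\<Sum>i\<le>s. \<Sum>j\<le>r. p ^ min i j)"

lemma divisors_prime_power:
  fixes p :: nat
  assumes "prime p"
  shows "bij_betw (\<lambda>i. p ^ i) {..k} {d. d dvd p ^ k}"
proof -
  have "p > 1" using assms by (rule prime_gt_1_nat)
  then have "inj_on (\<lambda>i. p ^ i) {..k}" by (auto intro!: inj_onI)
  moreover have "(\<lambda>i. p ^ i) ` {..k} = {d. d dvd p ^ k}"
    using divides_primepow_nat[OF assms] by auto
  ultimately show ?thesis by (simp add: bij_betw_def)
qed

lemma gcd_sum_prime_power: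
  assumes "prime p"
  shows "gcd_sum (p ^ s) (p ^ r) = power_min_sum p s r"
proof -
  have gcd: "gcd (p ^ i) (p ^ j) = p ^ min i j" for i j
  proof (cases "i \<le> j")
    case True
    then show ?thesis by (simp add: le_imp_power_dvd min_def)
  next
    case False
    then have "p ^ j dvd p ^ i" by (simp add: le_imp_power_dvd)
    then show ?thesis using False by (simp add: min_def gcd_proj2_if_dvd)
  qed
  show ?thesis
    unfolding gcd_sum_def power_min_sum_def gcd[symmetric]
    by (simp flip: sum.reindex_bij_betw[OF divisors_prime_power[OF assms]])
qed

lemma power_min_sum_commute: "power_min_sum p s r = power_min_sum p r s"
  unfolding power_min_sum_def by (subst sum.swap) (simp add: min.commute)

lemma power_min_sum_Suc_right:
  assumes "s \<le> r"
  shows "power_min_sum p s (Suc r) = power_min_sum p s r + (\<Sum>i\<le>s. p ^ i)"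
  unfolding power_min_sum_def using assms by (simp add: sum.distrib min_absorb1)

lemma power_min_sum_Suc_left:
  "power_min_sum p (Suc r) (Suc r) = power_min_sum p r (Suc r) + (\<Sum>j\<le>r. p ^ j) + p ^ Suc r"
  unfolding power_min_sum_def by (simp add: min_absorb2)

lemma geometric_sum_real: "(real p - 1) * real (\<Sum>i\<le>k. p ^ i) = real p ^ (k + 1) - 1"
  using power_diff_1_eq[of "real p" "k + 1"] by (simp add: lessThan_Suc_atMost)

text \<open>
  The square of side $r + 2$ arises from that of side $r + 1$ by adding a row and a column, each a
  geometric sum, and the corner $p^{r+1}$. Multiplying by $(p - 1)^2$ clears the denominators of these
  geometric sums.
\<close>

lemma power_min_sum_diagonal:
  "(real p - 1) ^ 2 * real (power_min_sum p r r)
     = real p ^ (r + 1) * (real p + 1) - ((2 * real r + 3) * (real p - 1) + 2)"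
proof (induction r)
  case 0
  then show ?case by (simp add: power_min_sum_def power2_eq_square algebra_simps)
next
  case (Suc r)
  have "power_min_sum p (Suc r) (Suc r)
          = power_min_sum p r r + 2 * (\<Sum>j\<le>r. p ^ j) + p ^ Suc r"
    by (simp add: power_min_sum_Suc_left power_min_sum_Suc_right)
  then have "(real p - 1) ^ 2 * real (power_min_sum p (Suc r) (Suc r))
      = (real p - 1) ^ 2 * real (power_min_sum p r r)
        + 2 * (real p - 1) * ((real p - 1) * real (\<Sum>j\<le>r. p ^ j))
        + (real p - 1) ^ 2 * real p ^ Suc r"
    by (simp add: power2_eq_square algebra_simps del: of_nat_sum)
  then show ?case
    unfolding Suc geometric_sum_real by (simp add: power2_eq_square algebra_simps)
qed

text \<open>
  Every column beyond the diagonal contributes the same geometric sum $\sum_{i \le r} p^i$, so the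
  value grows linearly in \<open>s\<close> from the square on the diagonal.
\<close>

lemma power_min_sum_closed_form:
  assumes "r \<le> s"
  shows "(real p - 1) ^ 2 * real (power_min_sum p r s)
     = real p ^ (r + 1) * ((real s - real r + 1) * (real p - 1) + 2)
         - ((real s + real r + 3) * (real p - 1) + 2)"
  using assms
proof (induction s rule: dec_induct)
  case base
  then show ?case by (simp add: power_min_sum_diagonal)
next
  case (step s)
  have "(real p - 1) ^ 2 * real (power_min_sum p r (Suc s))
      = (real p - 1) ^ 2 * real (power_min_sum p r s)
        + (real p - 1) * ((real p - 1) * real (\<Sum>i\<le>r. p ^ i))"
    using step.hyps by (simp add: power_min_sum_Suc_right power2_eq_square algebra_simps del: of_nat_sum)
  then show ?case
    unfolding step.IH geometric_sum_real by (simp add: algebra_simps)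
qed

text \<open>
  The sum is symmetric in the two exponents, so the closed form for ordered exponents applies to
  their minimum and maximum.
\<close>

lemma ideal_ratio_prime_power:
  assumes p: "prime p"
  shows "ideal_ratio (p ^ s) (p ^ r) =
           (real r + 1) * (real s + 1) * (real p - 1) ^ 2 /
           (real p ^ (min r s + 1) * ((\<bar>real s - real r\<bar> + 1) * (real p - 1) + 2)
              - ((real s + real r + 3) * (real p - 1) + 2))"
proof -
  have card: "card {d. d dvd p ^ k} = k + 1" for k
    using bij_betw_same_card[OF divisors_prime_power[OF p, of k]] by simp
  have closed: "(real p - 1) ^ 2 * real (power_min_sum p s r)
      = real p ^ (min r s + 1) * ((\<bar>real s - real r\<bar> + 1) * (real p - 1) + 2)
          - ((real s + real r + 3) * (real p - 1) + 2)"
  proof (cases "r \<le> s")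
    case True
    then show ?thesis
      using power_min_sum_closed_form[OF True, of p] by (simp add: power_min_sum_commute[of p s] min_def)
  next
    case False
    then show ?thesis
      using power_min_sum_closed_form[of s r p] by (simp add: min_def algebra_simps)
  qed
  have "(real p - 1) ^ 2 \<noteq> 0" using prime_gt_1_nat[OF p] by simp
  then show ?thesis
    unfolding ideal_ratio_def gcd_sum_prime_power[OF p] card closed[symmetric] by (simp add: mult.commute add.commute)
qed

section \<open>The probability that a subgroup is an ideal\<close>

theorem theorem5p4:
  shows "(\<forall>(p::nat) (r::nat) (s::nat).
            prime p \<longrightarrow> 0 < r \<longrightarrow> r \<le> s \<longrightarrow>
            ideal_prob (RDirProd (ZFact (int (p ^ r))) (ZFact (int (p ^ s)))) =
              (real r + 1) * (real s + 1) * (real p - 1) ^ 2 /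
              (real p ^ (r + 1) * ((real s - real r + 1) * (real p - 1) + 2)
                 - ((real s + real r + 3) * (real p - 1) + 2)))
       \<and> (\<forall>(n::nat) (m::nat) (k::nat) (p :: nat \<Rightarrow> nat) (r :: nat \<Rightarrow> nat) (s :: nat \<Rightarrow> nat).
            0 < n \<longrightarrow> 0 < m \<longrightarrow>
            inj_on p {1..k} \<longrightarrow> p ` {1..k} = {q. prime q \<and> q dvd m * n} \<longrightarrow>
            m = (\<Prod>i\<in>{1..k}. p i ^ r i) \<longrightarrow> n = (\<Prod>i\<in>{1..k}. p i ^ s i) \<longrightarrow>
            ideal_prob (RDirProd (ZFact (int n)) (ZFact (int m))) =
              (\<Prod>i\<in>{1..k}.
                 (real (r i) + 1) * (real (s i) + 1) * (real (p i) - 1) ^ 2 /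
                 (real (p i) ^ (min (r i) (s i) + 1)
                    * ((\<bar>real (s i) - real (r i)\<bar> + 1) * (real (p i) - 1) + 2)
                    - ((real (s i) + real (r i) + 3) * (real (p i) - 1) + 2))))"
proof (intro conjI allI impI)
  fix p r s :: nat
  assume p: "prime p" and "r \<le> s"
  then have "ideal_prob (RDirProd (ZFact (int (p ^ r))) (ZFact (int (p ^ s)))) = ideal_ratio (p ^ r) (p ^ s)"
    by (intro ideal_prob_ZFact_pair) (auto simp: prime_gt_0_nat)
  also have "\<dots> = (real r + 1) * (real s + 1) * (real p - 1) ^ 2 /
              (real p ^ (r + 1) * ((real s - real r + 1) * (real p - 1) + 2)
                 - ((real s + real r + 3) * (real p - 1) + 2))"
    unfolding ideal_ratio_prime_power[OF p] using \<open>r \<le> s\<close>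
    by (simp add: min_absorb2 abs_minus_commute[of "real r"] add.commute mult.commute)
  finally show "ideal_prob (RDirProd (ZFact (int (p ^ r))) (ZFact (int (p ^ s)))) = \<dots>" .
next
  fix n m k :: nat and p r s :: "nat \<Rightarrow> nat"
  assume pos: "0 < n" "0 < m" and inj: "inj_on p {1..k}"
    and img: "p ` {1..k} = {q. prime q \<and> q dvd m * n}"
    and m: "m = (\<Prod>i\<in>{1..k}. p i ^ r i)" and n: "n = (\<Prod>i\<in>{1..k}. p i ^ s i)"
  have prime: "prime (p i)" if "i \<in> {1..k}" for i using img that by blast
  have "ideal_prob (RDirProd (ZFact (int n)) (ZFact (int m))) = ideal_ratio n m"
    using pos by (rule ideal_prob_ZFact_pair)
  also have "\<dots> = (\<Prod>i\<in>{1..k}. ideal_ratio (p i ^ s i) (p i ^ r i))"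
    unfolding m n by (rule ideal_ratio_prod_prime_powers[OF _ inj prime]) auto
  finally show "ideal_prob (RDirProd (ZFact (int n)) (ZFact (int m))) =
              (\<Prod>i\<in>{1..k}.
                 (real (r i) + 1) * (real (s i) + 1) * (real (p i) - 1) ^ 2 /
                 (real (p i) ^ (min (r i) (s i) + 1)
                    * ((\<bar>real (s i) - real (r i)\<bar> + 1) * (real (p i) - 1) + 2)
                    - ((real (s i) + real (r i) + 3) * (real (p i) - 1) + 2)))"
    using ideal_ratio_prime_power[OF prime] by simp
qed

end
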